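(* Let $n,m,r\ge1$ and $\phi:\mathbb{R}^{n\times r}\times\mathbb{R}^{m\times r}\to\mathbb{R}^{n\times m}$, $\phi(U,V)=UV^\top$. Let $(U,V)$ be such that the vertical concatenation $(U;V)\in\mathbb{R}^{(n+m)\times r}$ has full rank $\mathtt{rk}$. Then, near $(U,V)$, all conservation laws of $\phi$ are given by $\Psi:(U,V)\mapsto U^\top U-V^\top V\in\mathbb{R}^{r\times r}$, in the following sense: for every $\mathcal{C}^1$ conservation law $h$ of $\phi$ on an open neighborhood of $(U,V)$, $\nabla h(U,V)\in\operatorname{span}\{\nabla\Psi_{i,j}(U,V):1\le i,j\le r\}$. In particular there exist no more independent conservation laws: on a neighborhood of $(U,V)$ the maximal number of independent conservation laws of $\phi$ is $\mathtt{rk}(2r+1-\mathtt{rk})/2$, and it is attained by entries of $\Psi$.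
   Context: Write $\theta=(U,V)\in\mathbb{R}^D$, $D=(n+m)r$. $W_\phi$ is the span of the gradient vector fields $\nabla\phi_{k,l}$ of the entries of $\phi$. A $\mathcal{C}^1$ function $h$ on an open set $\Omega\subseteq\mathbb{R}^D$ is a conservation law of $\phi$ on $\Omega$ if it is constant along all solutions in $\Omega$ of $\dot\theta=\chi(\theta)$, for all $\chi\in W_\phi$. A family $(h_1,\dots,h_N)$ of conservation laws on $\Omega$ is independent if $\nabla h_1(\theta),\dots,\nabla h_N(\theta)$ are linearly independent for every $\theta\in\Omega$. *)

theory Defs
  imports "HOL-Analysis.Analysis"
begin

definition gradient :: "('a::real_inner \<Rightarrow> real) \<Rightarrow> 'a \<Rightarrow> 'a"
  where "gradient f x = (THE D. GDERIV f x :> D)"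

lemma gradient_eq: "GDERIV f x :> D \<Longrightarrow> gradient f x = D"
proof -
  have "D = E" if D: "GDERIV f x :> D" and E: "GDERIV f x :> E" for D E
  proof -
    have "(\<lambda>h. inner h D) = (\<lambda>h. inner h E)"
      using has_derivative_unique D E unfolding gderiv_def by blast
    then have "inner h (D - E) = 0" for h
      by (metis inner_diff_right right_minus_eq)
    then show "D = E"
      by (metis inner_eq_zero_iff right_minus_eq)
  qed
  then show "GDERIV f x :> D \<Longrightarrow> gradient f x = D"
    unfolding gradient_def by blast
qed

definition C1_on :: "'a::euclidean_space set \<Rightarrow> ('a \<Rightarrow> real) \<Rightarrow> bool"
  where "C1_on \<Omega> h \<longleftrightarrow> (\<forall>x\<in>\<Omega>. h differentiable (at x)) \<and> continuous_on \<Omega> (gradient h)"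

text \<open>The function type carries no real vector space instance, so the linear span of the
  finitely many gradient fields of the entries of \<open>\<phi>\<close> is written out. The coefficients are
  constants, independent of the point \<open>x\<close>.\<close>

definition W :: "('a::euclidean_space \<Rightarrow> real^'m^'n) \<Rightarrow> ('a \<Rightarrow> 'a) set"
  where "W \<phi> = {f. \<exists>c :: 'n \<Rightarrow> 'm \<Rightarrow> real.
    f = (\<lambda>x. \<Sum>k\<in>UNIV. \<Sum>l\<in>UNIV. c k l *\<^sub>R gradient (\<lambda>y. \<phi> y $ k $ l) x)}"

text \<open>Solutions may live on any interval, open or not; at an end point belonging to the
  interval the derivative is one-sided.\<close>

definition solution_in :: "'a::euclidean_space set \<Rightarrow> ('a \<Rightarrow> 'a) \<Rightarrow> real set \<Rightarrow> (real \<Rightarrow> 'a) \<Rightarrow> bool"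
  where "solution_in \<Omega> f I \<theta> \<longleftrightarrow> is_interval I \<and> \<theta> ` I \<subseteq> \<Omega> \<and>
    (\<forall>t\<in>I. (\<theta> has_vector_derivative f (\<theta> t)) (at t within I))"

text \<open>Intended for open \<open>\<Omega>\<close>; only the values of \<open>h\<close> on \<open>\<Omega>\<close> matter.\<close>

definition conservation_law ::
    "('a::euclidean_space \<Rightarrow> real^'m^'n) \<Rightarrow> 'a set \<Rightarrow> ('a \<Rightarrow> real) \<Rightarrow> bool"
  where "conservation_law \<phi> \<Omega> h \<longleftrightarrow> C1_on \<Omega> h \<and>
    (\<forall>f\<in>W \<phi>. \<forall>I \<theta>. solution_in \<Omega> f I \<theta> \<longrightarrow> (\<lambda>t. h (\<theta> t)) constant_on I)"

text \<open>The family is indexed by \<open>i < N\<close>. Since \<open>independent\<close> speaks about sets, the gradients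
  are additionally required to be pairwise distinct.\<close>

definition independent_laws ::
    "('a::euclidean_space \<Rightarrow> real^'m^'n) \<Rightarrow> 'a set \<Rightarrow> nat \<Rightarrow> (nat \<Rightarrow> 'a \<Rightarrow> real) \<Rightarrow> bool"
  where "independent_laws \<phi> \<Omega> N h \<longleftrightarrow>
    (\<forall>i<N. conservation_law \<phi> \<Omega> (h i)) \<and>
    (\<forall>x\<in>\<Omega>. inj_on (\<lambda>i. gradient (h i) x) {..<N} \<and>
            independent ((\<lambda>i. gradient (h i) x) ` {..<N}))"

definition \<phi> :: "(real^'r^'n) \<times> (real^'r^'m) \<Rightarrow> real^'m^'n"
  where "\<phi> = (\<lambda>(U, V). U ** transpose V)"

definition \<Psi> :: "(real^'r^'n) \<times> (real^'r^'m) \<Rightarrow> real^'r^'r"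
  where "\<Psi> = (\<lambda>(U, V). transpose U ** U - transpose V ** V)"

definition vconcat :: "real^'r^'n \<Rightarrow> real^'r^'m \<Rightarrow> real^'r^('n + 'm)"
  where "vconcat U V = (\<chi> i. case i of Inl k \<Rightarrow> U $ k | Inr l \<Rightarrow> V $ l)"

end

(* If h is conserved by every field F of phi, its gradient G at theta is orthogonal to F theta, and,
   since h is invariant under the flow of F, also to the bracket of any two such fields at theta.
   Stack theta to X and G, with its lower block negated, to G'. The fields of phi and their first
   brackets span the Lie algebra so(n,m), so this orthogonality says exactly that G' X^T is
   symmetric. As X has full rank it has a one-sided inverse, and then G' = X S with S symmetric,
   which is the general form of an element of the span of the gradients of the entries of Psi.

   For the dimension of that span, choose a set C of rk columns of X that form a basis of its column
   space. The gradients of the Psi_ij with i or j in C form a basis of the span: for a symmetric S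
   with S_ij = 0 whenever neither i nor j is in C, X S = 0 forces S = 0, and the remaining gradients reduce to
   these because the gradient field is bilinear in (e_i, e_j) and vanishes at
   pairs from the kernel of X.
   There are rk (2r + 1 - rk) / 2 of them up to the order of i and j, and they remain independent
   near theta. *)

theory Submission
  imports Defs
begin

section \<open>Gradients of functions that are constant along explicit linear flows\<close>

lemma differentiable_GDERIV_gradient:
  fixes h :: "'a::euclidean_space \<Rightarrow> real"
  assumes "h differentiable (at x)"
  shows "GDERIV h x :> gradient h x"
proof -
  obtain h' where h': "(h has_derivative h') (at x)"
    using assms unfolding differentiable_def by blast
  then have "linear h'"
    by (rule has_derivative_linear)
  then have "h' = (\<lambda>y. y \<bullet> adjoint h' 1)"
    by (simp add: adjoint_works fun_eq_iff)
  then have "GDERIV h x :> adjoint h' 1"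
    using h' by (simp add: gderiv_def)
  then show ?thesis
    using gradient_eq by metis
qed

text \<open>When \<open>F\<close> is linear with \<open>F\<^sup>3 = F\<close>, this is the exponential \<open>exp (t F)\<close> in closed form.\<close>

definition flow :: "('a::real_vector \<Rightarrow> 'a) \<Rightarrow> real \<Rightarrow> 'a \<Rightarrow> 'a"
  where "flow F t x = x + sinh t *\<^sub>R F x + (cosh t - 1) *\<^sub>R F (F x)"

text \<open>From \<open>F (F (F x)) = F x\<close> it follows that \<open>F \<circ> F\<close> is a
  projection, so the odd and even parts of the exponential series sum to \<open>sinh\<close> and
  \<open>cosh\<close>. The gradient fields of the entries of \<open>\<phi>\<close> are of this
  kind.\<close>

locale cubic_field =
  fixes F :: "'a::euclidean_space \<Rightarrow> 'a"
  assumes lin: "linear F"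
    and cubic: "F (F (F x)) = F x"
begin

lemmas F_simps = linear_add[OF lin] linear_diff[OF lin] linear_scale[OF lin]

lemma flow_0 [simp]: "flow F 0 x = x"
  by (simp add: flow_def)

lemma F_flow: "F (flow F t x) = cosh t *\<^sub>R F x + sinh t *\<^sub>R F (F x)"
  by (simp add: flow_def F_simps cubic algebra_simps)

lemma FF_flow: "F (F (flow F t x)) = cosh t *\<^sub>R F (F x) + sinh t *\<^sub>R F x"
  by (simp add: F_flow F_simps cubic)

lemma flow_minus: "flow F (- t) (flow F t x) = x"
proof -
  have sq: "cosh t * cosh t = 1 + sinh t * sinh t"
    using cosh_square_eq[of t] by (simp add: power2_eq_square)
  have "flow F (- t) (flow F t x) = x + (sinh t + - sinh t * cosh t + (cosh t - 1) * sinh t) *\<^sub>R F x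
      + ((cosh t - 1) - sinh t * sinh t + (cosh t - 1) * cosh t) *\<^sub>R F (F x)"
    unfolding flow_def[of F "- t" "flow F t x"] FF_flow unfolding F_flow
    by (simp add: flow_def algebra_simps)
  also have "\<dots> = x"
    by (simp add: algebra_simps sq)
  finally show ?thesis .
qed

lemma linear_flow: "linear (flow F t)"
  by (rule linearI)
    (simp_all add: flow_def F_simps algebra_simps)

lemma flow_has_vector_derivative:
  "((\<lambda>t. flow F t x) has_vector_derivative F (flow F t x)) (at t within S)"
  unfolding F_flow unfolding flow_def
  by (auto intro!: derivative_eq_intros simp: algebra_simps)

lemma continuous_flow: "continuous_on UNIV (\<lambda>(t, x). flow F t x)"
  unfolding flow_def case_prod_beta
  by (intro continuous_intros linear_continuous_on_compose[OF _ lin])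

text \<open>Joint continuity of the flow at \<open>(0, x)\<close> yields one time bound valid for a
  whole ball of starting points. This uniformity allows the identity
  \<open>h (flow F t y) = h y\<close> to be differentiated in \<open>y\<close> for fixed
  \<open>t\<close>.\<close>

lemma flow_conserves:
  assumes \<Omega>: "open \<Omega>" "x \<in> \<Omega>"
    and cons: "\<And>I \<theta>. solution_in \<Omega> F I \<theta> \<Longrightarrow> (\<lambda>t. h (\<theta> t)) constant_on I"
  obtains \<delta> where "\<delta> > 0"
    "\<And>t y. \<bar>t\<bar> < \<delta> \<Longrightarrow> y \<in> ball x \<delta> \<Longrightarrow> flow F t y \<in> \<Omega> \<and> h (flow F t y) = h y"
proof -
  let ?P = "(\<lambda>(t, x). flow F t x) -` \<Omega>"
  have "open ?P"
    using continuous_flow \<Omega>(1) by (simp add: continuous_on_open_vimage)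
  moreover have "(0, x) \<in> ?P"
    using \<Omega>(2) by simp
  ultimately obtain A B where AB: "open A" "open B" "0 \<in> A" "x \<in> B" "A \<times> B \<subseteq> ?P"
    using open_prod_elim by (metis mem_Sigma_iff)
  obtain a b where ab: "a > 0" "ball 0 a \<subseteq> A" "b > 0" "ball x b \<subseteq> B"
    using AB openE by metis
  have in\<Omega>: "flow F t y \<in> \<Omega>" if "\<bar>t\<bar> < min a b" "y \<in> ball x (min a b)" for t y
  proof -
    have "t \<in> A" "y \<in> B"
      using that ab by (auto simp: subset_eq dist_real_def)
    then show ?thesis
      using AB(5) by auto
  qed
  have "h (flow F t y) = h y" if "\<bar>t\<bar> < min a b" "y \<in> ball x (min a b)" for t y
  proof -
    \<comment> \<open>A symmetric interval contains both \<open>0\<close> and \<open>t\<close>,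
      whatever the sign of \<open>t\<close>.\<close>
    let ?I = "{- \<bar>t\<bar>..\<bar>t\<bar>}"
    have "solution_in \<Omega> F ?I (\<lambda>t. flow F t y)"
      using that unfolding solution_in_def
      by (auto simp: flow_has_vector_derivative is_interval_cc intro!: in\<Omega>)
    then have "(\<lambda>t. h (flow F t y)) constant_on ?I"
      by (rule cons)
    then obtain c where c: "\<And>s. s \<in> ?I \<Longrightarrow> h (flow F s y) = c"
      unfolding constant_on_def by blast
    have "h (flow F t y) = h (flow F 0 y)"
      using c[of t] c[of 0] by (auto simp: abs_if)
    then show ?thesis by simp
  qed
  then show ?thesis
    using that[of "min a b"] ab in\<Omega> by auto
qed

text \<open>By the chain rule the inner product is the derivative at \<open>0\<close> of
  \<open>h\<close> along the flow line through \<open>x\<close>, where \<open>h\<close> is constant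
  near \<open>0\<close>.\<close>

lemma gradient_orthogonal:
  assumes \<Omega>: "open \<Omega>" "x \<in> \<Omega>"
    and h: "h differentiable (at x)"
    and cons: "\<And>I \<theta>. solution_in \<Omega> F I \<theta> \<Longrightarrow> (\<lambda>t. h (\<theta> t)) constant_on I"
  shows "gradient h x \<bullet> F x = 0"
proof -
  obtain \<delta> where \<delta>: "\<delta> > 0"
    "\<And>t y. \<bar>t\<bar> < \<delta> \<Longrightarrow> y \<in> ball x \<delta> \<Longrightarrow> flow F t y \<in> \<Omega> \<and> h (flow F t y) = h y"
    using flow_conserves[OF \<Omega>, of h] cons by blast
  have "(h has_derivative (\<lambda>v. v \<bullet> gradient h x)) (at (flow F 0 x))"
    using differentiable_GDERIV_gradient[OF h] by (simp add: gderiv_def)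
  then have "((\<lambda>t. h (flow F t x)) has_derivative (\<lambda>s. (s *\<^sub>R F x) \<bullet> gradient h x)) (at 0)"
    using has_derivative_compose[OF flow_has_vector_derivative[of x 0 UNIV, unfolded has_vector_derivative_def]]
    unfolding flow_0 by blast
  moreover have "((\<lambda>t. h (flow F t x)) has_derivative (\<lambda>s. 0)) (at 0)"
    by (rule has_derivative_transform_within_open[where f = "\<lambda>t. h x" and s = "ball 0 \<delta>"])
      (use \<delta> in \<open>auto simp: dist_real_def\<close>)
  ultimately have "(\<lambda>s. (s *\<^sub>R F x) \<bullet> gradient h x) = (\<lambda>s. 0)"
    by (rule has_derivative_unique)
  then have "(1 *\<^sub>R F x) \<bullet> gradient h x = 0"
    by meson
  then show ?thesis
    by (simp add: inner_commute)
qed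

text \<open>Differentiating \<open>h (flow F t y) = h y\<close> in \<open>y\<close> shows that \<open>h\<close> is also conserved along the
  pullback of \<open>K\<close> by the flow of \<open>F\<close>; the derivative of this pullback at \<open>t = 0\<close> is the
  Lie bracket. No second derivative of \<open>h\<close> is needed.\<close>

lemma gradient_orthogonal_bracket:
  assumes \<Omega>: "open \<Omega>" "x \<in> \<Omega>"
    and h: "\<And>y. y \<in> \<Omega> \<Longrightarrow> h differentiable (at y)"
    and cons: "\<And>I \<theta>. solution_in \<Omega> F I \<theta> \<Longrightarrow> (\<lambda>t. h (\<theta> t)) constant_on I"
    and K: "linear K" "\<And>y. y \<in> \<Omega> \<Longrightarrow> gradient h y \<bullet> K y = 0"
  shows "gradient h x \<bullet> K (F x) = gradient h x \<bullet> F (K x)"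
proof -
  obtain \<delta> where \<delta>: "\<delta> > 0"
    "\<And>t y. \<bar>t\<bar> < \<delta> \<Longrightarrow> y \<in> ball x \<delta> \<Longrightarrow> flow F t y \<in> \<Omega> \<and> h (flow F t y) = h y"
    using flow_conserves[OF \<Omega>, of h] cons by blast
  have pullback: "gradient h x \<bullet> flow F (- t) (K (flow F t x)) = 0" if t: "\<bar>t\<bar> < \<delta>" for t
  proof -
    have in\<Omega>: "flow F t x \<in> \<Omega>"
      using \<delta> t by simp
    have "(h has_derivative (\<lambda>v. v \<bullet> gradient h (flow F t x))) (at (flow F t x))"
      using differentiable_GDERIV_gradient[OF h[OF in\<Omega>]] by (simp add: gderiv_def)
    then have "((\<lambda>y. h (flow F t y)) has_derivative (\<lambda>v. flow F t v \<bullet> gradient h (flow F t x))) (at x)"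
      using has_derivative_compose[OF linear_imp_has_derivative[OF linear_flow]] by blast
    moreover have "((\<lambda>y. h (flow F t y)) has_derivative (\<lambda>v. v \<bullet> gradient h x)) (at x)"
      by (rule has_derivative_transform_within_open[where f = h and s = "ball x \<delta>"])
        (use \<delta> t differentiable_GDERIV_gradient[OF h[OF \<Omega>(2)]] in \<open>auto simp: gderiv_def\<close>)
    ultimately have eq: "(\<lambda>v. flow F t v \<bullet> gradient h (flow F t x)) = (\<lambda>v. v \<bullet> gradient h x)"
      by (rule has_derivative_unique)
    \<comment> \<open>The identity of derivatives is evaluated at the pulled back vector; the two
      flows then cancel and leave \<open>K\<close> at the point \<open>flow F t x\<close>, where it
      is orthogonal to the gradient.\<close>
    have "flow F (- t) (K (flow F t x)) \<bullet> gradient h x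
        = flow F t (flow F (- t) (K (flow F t x))) \<bullet> gradient h (flow F t x)"
      using fun_cong[OF eq] by simp
    also have "\<dots> = 0"
      using flow_minus[of "- t"] K(2)[OF in\<Omega>] by (simp add: inner_commute)
    finally show ?thesis
      by (simp add: inner_commute)
  qed
  let ?f = "\<lambda>t. gradient h x \<bullet> flow F (- t) (K (flow F t x))"
  have "(?f has_real_derivative gradient h x \<bullet> (K (F x) - F (K x))) (at 0)"
    unfolding flow_def
    by (auto simp: linear_add[OF K(1)] linear_scale[OF K(1)] F_simps
        inner_add_right inner_diff_right intro!: derivative_eq_intros)
  moreover have "(?f has_real_derivative 0) (at 0)"
    by (rule has_field_derivative_transform_within_open[OF DERIV_const, of "ball 0 \<delta>"])
      (use \<delta> pullback in \<open>auto simp: dist_real_def\<close>)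
  ultimately show ?thesis
    using DERIV_unique by (fastforce simp: inner_diff_right)
qed

end

section \<open>The gradient fields of the entries of \<open>\<phi>\<close>\<close>

definition cross_field :: "'n \<Rightarrow> 'm \<Rightarrow> (real^'r^'n) \<times> (real^'r^'m) \<Rightarrow> (real^'r^'n) \<times> (real^'r^'m)"
  where "cross_field k l \<theta> =
    (\<chi> a. if a = k then snd \<theta> $ l else 0, \<chi> b. if b = l then fst \<theta> $ k else 0)"

lemma inner_cross_field:
  "\<xi> \<bullet> cross_field k l \<theta> = fst \<xi> $ k \<bullet> snd \<theta> $ l + snd \<xi> $ l \<bullet> fst \<theta> $ k"
  by (simp add: cross_field_def inner_prod_def inner_vec_def[where 'a = "real^'r"]
      if_distrib[where f = "\<lambda>x. _ \<bullet> x"] cong: if_cong)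

lemma linear_cross_field: "linear (cross_field k l)"
  by (rule linearI) (auto simp: cross_field_def vec_eq_iff)

text \<open>The field exchanges row \<open>k\<close> of the first block with row \<open>l\<close> of
  the second and kills all other rows. Its square is therefore the projection onto these two
  rows.\<close>

interpretation cross: cubic_field "cross_field k l" for k l
  by unfold_locales (auto simp: linear_cross_field cross_field_def vec_eq_iff)

lemma has_derivative_row_fst:
  "((\<lambda>\<theta>. fst \<theta> $ k) has_derivative (\<lambda>v. fst v $ k)) (at \<theta>)"
  by (intro bounded_linear_imp_has_derivative bounded_linear_compose[OF bounded_linear_vec_nth bounded_linear_fst])

lemma has_derivative_row_snd:
  "((\<lambda>\<theta>. snd \<theta> $ l) has_derivative (\<lambda>v. snd v $ l)) (at \<theta>)"
  by (intro bounded_linear_imp_has_derivative bounded_linear_compose[OF bounded_linear_vec_nth bounded_linear_snd])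

lemma gradient_phi:
  fixes \<theta> :: "(real^'r^'n) \<times> (real^'r^'m)"
  shows "gradient (\<lambda>\<theta>. \<phi> \<theta> $ k $ l) \<theta> = cross_field k l \<theta>"
proof (rule gradient_eq)
  have "(\<lambda>\<theta> :: (real^'r^'n) \<times> (real^'r^'m). \<phi> \<theta> $ k $ l) = (\<lambda>\<theta>. fst \<theta> $ k \<bullet> snd \<theta> $ l)"
    by (auto simp: \<phi>_def matrix_matrix_mult_def transpose_def inner_vec_def)
  then show "GDERIV (\<lambda>\<theta>. \<phi> \<theta> $ k $ l) \<theta> :> cross_field k l \<theta>"
    unfolding gderiv_def inner_cross_field
    by (auto intro!: derivative_eq_intros has_derivative_row_fst has_derivative_row_snd
        simp: inner_commute)
qed

lemma cross_field_in_W: "cross_field k l \<in> W \<phi>"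
  unfolding W_def gradient_phi
  by (rule CollectI, rule exI[of _ "\<lambda>a b. if a = k then if b = l then 1 else 0 else 0"])
    (simp add: if_distrib[where f = "\<lambda>c. c *\<^sub>R _"] if_distrib[where f = "sum _"] fun_eq_iff
      sum.If_cases cong: if_cong)

section \<open>The gradient fields of the entries of \<open>\<Psi>\<close>\<close>

definition form_field :: "real^'r \<Rightarrow> real^'r \<Rightarrow> (real^'r^'n) \<times> (real^'r^'m) \<Rightarrow> (real^'r^'n) \<times> (real^'r^'m)"
  where "form_field u v \<theta> =
    (\<chi> k. (fst \<theta> $ k \<bullet> u) *\<^sub>R v + (fst \<theta> $ k \<bullet> v) *\<^sub>R u,
     \<chi> l. - ((snd \<theta> $ l \<bullet> u) *\<^sub>R v + (snd \<theta> $ l \<bullet> v) *\<^sub>R u))"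

lemma form_field_commute: "form_field u v \<theta> = form_field v u \<theta>"
  by (simp add: form_field_def add.commute)

lemma linear_form_field: "linear (form_field u v)"
  by (rule linearI) (auto simp: form_field_def vec_eq_iff inner_add_left algebra_simps)

lemma linear_form_field_left: "linear (\<lambda>u. form_field u v \<theta>)"
  by (rule linearI) (auto simp: form_field_def vec_eq_iff inner_add_right algebra_simps)

lemma GDERIV_Psi:
  fixes \<theta> :: "(real^'r^'n) \<times> (real^'r^'m)"
  shows "GDERIV (\<lambda>\<theta>. \<Psi> \<theta> $ i $ j) \<theta> :> form_field (axis i 1) (axis j 1) \<theta>"
proof -
  have "(\<lambda>\<theta> :: (real^'r^'n) \<times> (real^'r^'m). \<Psi> \<theta> $ i $ j) =
    (\<lambda>\<theta>. (\<Sum>k\<in>UNIV. (fst \<theta> $ k \<bullet> axis i 1) * (fst \<theta> $ k \<bullet> axis j 1))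
      - (\<Sum>l\<in>UNIV. (snd \<theta> $ l \<bullet> axis i 1) * (snd \<theta> $ l \<bullet> axis j 1)))"
    by (auto simp: \<Psi>_def matrix_matrix_mult_def transpose_def inner_axis)
  then show ?thesis
    unfolding gderiv_def
    by (auto intro!: derivative_eq_intros has_derivative_row_fst has_derivative_row_snd
        simp: form_field_def inner_prod_def inner_vec_def[where 'a = "real^'r"]
          inner_add_right sum_negf ac_simps simp del: minus_add_distrib)
qed

lemma gradient_Psi:
  "gradient (\<lambda>\<theta>. \<Psi> \<theta> $ i $ j) = form_field (axis i 1) (axis j 1)"
  by (rule ext, rule gradient_eq, rule GDERIV_Psi)

text \<open>Against a single \<open>cross_field k l\<close> both blocks contribute the same two
  products of inner products, with opposite signs.\<close>

lemma form_field_orthogonal_W: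
  assumes "f \<in> W \<phi>"
  shows "form_field u v \<theta> \<bullet> f \<theta> = 0"
proof -
  have "form_field u v \<theta> \<bullet> cross_field k l \<theta> = 0" for k l
    unfolding inner_cross_field by (simp add: form_field_def inner_simps inner_commute)
  then show ?thesis
    using assms unfolding W_def gradient_phi by (auto simp: inner_sum_right)
qed

lemma conservation_law_Psi: "conservation_law \<phi> \<Omega> (\<lambda>\<theta>. \<Psi> \<theta> $ i $ j)"
  unfolding conservation_law_def
proof (intro conjI ballI allI impI)
  show "C1_on \<Omega> (\<lambda>\<theta>. \<Psi> \<theta> $ i $ j)"
    unfolding C1_on_def gradient_Psi
    using GDERIV_Psi linear_continuous_on[OF linear_conv_bounded_linear[THEN iffD1, OF linear_form_field]]
    unfolding gderiv_def differentiable_def by blast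
next
  fix f I \<theta>
  assume f: "f \<in> W \<phi>" and sol: "solution_in \<Omega> f I \<theta>"
  have "((\<lambda>t. \<Psi> (\<theta> t) $ i $ j) has_derivative (\<lambda>s. 0)) (at t within I)" if "t \<in> I" for t
  proof -
    have "(\<theta> has_derivative (\<lambda>s. s *\<^sub>R f (\<theta> t))) (at t within I)"
      using sol that unfolding solution_in_def has_vector_derivative_def by blast
    then have "((\<lambda>t. \<Psi> (\<theta> t) $ i $ j) has_derivative
        (\<lambda>s. (s *\<^sub>R f (\<theta> t)) \<bullet> form_field (axis i 1) (axis j 1) (\<theta> t))) (at t within I)"
      using has_derivative_compose GDERIV_Psi[unfolded gderiv_def] by blast
    then show ?thesis
      using form_field_orthogonal_W[OF f] by (simp add: inner_commute)
  qed
  moreover have "convex I"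
    using sol is_interval_convex unfolding solution_in_def by blast
  ultimately show "(\<lambda>t. \<Psi> (\<theta> t) $ i $ j) constant_on I"
    unfolding constant_on_def using has_derivative_zero_constant by blast
qed

section \<open>Symmetry imposed on the gradient of a conservation law\<close>

text \<open>In matrix form: for the stacked matrices \<open>X\<close> of \<open>\<theta>\<close> and \<open>G\<close> of the gradient (the latter
  with its lower block negated), \<open>G X\<^sup>T\<close> is symmetric. Off-diagonal blocks express invariance
  under the fields of \<open>\<phi>\<close>, diagonal blocks invariance under their brackets.\<close>

lemma conservation_law_gradient_symmetric:
  fixes h :: "(real^'r^'n) \<times> (real^'r^'m) \<Rightarrow> real"
  assumes \<Omega>: "open \<Omega>" "\<theta> \<in> \<Omega>"
    and cl: "conservation_law \<phi> \<Omega> h"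
  defines "X \<equiv> vconcat (fst \<theta>) (snd \<theta>)"
    and "G \<equiv> vconcat (fst (gradient h \<theta>)) (- snd (gradient h \<theta>))"
  shows "G $ p \<bullet> X $ q = G $ q \<bullet> X $ p"
proof -
  have diff: "h differentiable (at x)" if "x \<in> \<Omega>" for x
    using cl that unfolding conservation_law_def C1_on_def by blast
  have cons: "(\<lambda>t. h (\<eta> t)) constant_on I" if "solution_in \<Omega> (cross_field k l) I \<eta>" for k l I \<eta>
    using cl cross_field_in_W that unfolding conservation_law_def by blast
  have orth: "gradient h x \<bullet> cross_field k l x = 0" if "x \<in> \<Omega>" for k l x
    using cross.gradient_orthogonal[OF \<Omega>(1) that diff[OF that] cons] .
  have bracket: "gradient h \<theta> \<bullet> cross_field k' l' (cross_field k l \<theta>)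
      = gradient h \<theta> \<bullet> cross_field k l (cross_field k' l' \<theta>)" for k l k' l'
    using cross.gradient_orthogonal_bracket[OF \<Omega> diff cons linear_cross_field orth] .
  have off: "fst (gradient h \<theta>) $ k \<bullet> snd \<theta> $ l = - (snd (gradient h \<theta>) $ l \<bullet> fst \<theta> $ k)" for k l
    using orth[OF \<Omega>(2), of k l] unfolding inner_cross_field by simp
  \<comment> \<open>Two fields sharing their second index have a bracket that acts only on rows
    \<open>k\<close> and \<open>k'\<close> of the first block. Any shared index will do, hence
    \<open>undefined\<close>.\<close>
  have upper: "fst (gradient h \<theta>) $ k \<bullet> fst \<theta> $ k' = fst (gradient h \<theta>) $ k' \<bullet> fst \<theta> $ k" for k k'
    using bracket[of k undefined k' undefined] unfolding inner_cross_field
    by (cases "k = k'") (auto simp: cross_field_def)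
  have lower: "snd (gradient h \<theta>) $ l \<bullet> snd \<theta> $ l' = snd (gradient h \<theta>) $ l' \<bullet> snd \<theta> $ l" for l l'
    using bracket[of undefined l undefined l'] unfolding inner_cross_field
    by (cases "l = l'") (auto simp: cross_field_def)
  show ?thesis
    unfolding X_def G_def vconcat_def using off upper lower
    by (cases p; cases q) auto
qed

section \<open>Column bases, symmetric factors and independent families\<close>

lemma matrix_vector_mult_columns:
  fixes X :: "real^'n^'m"
  shows "X *v c = (\<Sum>i\<in>UNIV. c $ i *\<^sub>R column i X)"
  by (simp add: matrix_mult_sum scalar_mult_eq_scaleR)

text \<open>The columns indexed by \<open>C\<close> form a basis of the column space. Independence
  and spanning are both phrased through coefficient vectors supported on \<open>C\<close>, the form
  in which they are applied to symmetric matrices and to \<open>form_field\<close>.\<close>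

lemma column_basis:
  fixes X :: "real^'n^'m"
  obtains C where "card C = rank X"
    "\<And>c. (\<And>i. i \<notin> C \<Longrightarrow> c $ i = 0) \<Longrightarrow> X *v c = 0 \<Longrightarrow> c = 0"
    "\<And>i. \<exists>c. (\<forall>j. j \<notin> C \<longrightarrow> c $ j = 0) \<and> X *v c = X *v axis i 1"
proof -
  obtain B where B: "B \<subseteq> columns X" "independent B" "columns X \<subseteq> span B" "card B = rank X"
    using basis_exists[of "columns X"] by (metis column_rank_def)
  have "finite B"
    using B(2) independent_imp_finite by blast
  \<comment> \<open>Columns may repeat, so one index is chosen for each basis vector.\<close>
  define \<kappa> where "\<kappa> b = (SOME i. column i X = b)" for b
  have \<kappa>: "column (\<kappa> b) X = b" if "b \<in> B" for b
    unfolding \<kappa>_def using B(1) that by (auto simp: columns_def intro: someI)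
  then have inj: "inj_on \<kappa> B"
    by (metis inj_onI)
  have mult: "X *v c = (\<Sum>b\<in>B. c $ \<kappa> b *\<^sub>R b)" if "\<And>i. i \<notin> \<kappa> ` B \<Longrightarrow> c $ i = 0" for c
  proof -
    have "X *v c = (\<Sum>i\<in>\<kappa> ` B. c $ i *\<^sub>R column i X)"
      unfolding matrix_vector_mult_columns using that by (intro sum.mono_neutral_right) auto
    also have "\<dots> = (\<Sum>b\<in>B. c $ \<kappa> b *\<^sub>R b)"
      using \<kappa> by (simp add: sum.reindex[OF inj])
    finally show ?thesis .
  qed
  show ?thesis
  proof (rule that[of "\<kappa> ` B"])
    show "card (\<kappa> ` B) = rank X"
      using inj B(4) by (simp add: card_image)
  next
    fix c
    assume c: "\<And>i. i \<notin> \<kappa> ` B \<Longrightarrow> c $ i = 0" and "X *v c = 0"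
    then have "(\<Sum>b\<in>B. c $ \<kappa> b *\<^sub>R b) = 0"
      using mult by simp
    then have "c $ \<kappa> b = 0" if "b \<in> B" for b
      using B(2) \<open>finite B\<close> that by (auto simp: dependent_finite)
    then show "c = 0"
      using c by (metis imageE vec_eq_iff zero_index)
  next
    fix i
    have "column i X \<in> span B"
      using B(3) by (auto simp: columns_def)
    then obtain \<beta> where \<beta>: "column i X = (\<Sum>b\<in>B. \<beta> b *\<^sub>R b)"
      using \<open>finite B\<close> by (auto simp: span_finite)
    define c :: "real^'n" where "c = (\<chi> j. if j \<in> \<kappa> ` B then \<beta> (column j X) else 0)"
    have "X *v c = column i X"
      unfolding \<beta> by (subst mult) (auto simp: c_def \<kappa> intro!: sum.cong)
    then show "\<exists>c. (\<forall>j. j \<notin> \<kappa> ` B \<longrightarrow> c $ j = 0) \<and> X *v c = X *v axis i 1"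
      by (intro exI[of _ c]) (auto simp: c_def matrix_vector_mult_basis)
  qed
qed

lemma matrix_diff_ldistrib: "A ** (B - C) = A ** B - A ** C"
  for A :: "'a::ring_1^'n^'m"
  by (simp add: matrix_matrix_mult_def vec_eq_iff right_diff_distrib sum_subtractf)

text \<open>Converse to the symmetry of X S X^T for symmetric S. Full rank provides an inverse of
  \<open>X\<close> on the right or on the left, according to which dimension is smaller.\<close>

lemma full_rank_symmetric_factor:
  fixes X G :: "real^'r^'p"
  assumes rank: "rank X = min CARD('p) CARD('r)"
    and sym: "G ** transpose X = X ** transpose G"
  obtains S where "transpose S = S" "G = X ** S"
proof -
  obtain Q where Q: "X ** Q = mat 1 \<or> Q ** X = mat 1"
  proof (cases "CARD('p) \<le> CARD('r)")
    case True
    then have "surj ((*v) X)"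
      using rank full_rank_surjective[of X] by simp
    then show ?thesis
      using that matrix_right_invertible_surjective by blast
  next
    case False
    then have "inj ((*v) X)"
      using rank full_rank_injective[of X] by simp
    then show ?thesis
      using that matrix_left_invertible_injective by blast
  qed
  \<comment> \<open>One formula serves both cases. It is symmetric because G X^T is. In
    \<open>X ** S\<close> the last term cancels the second if \<open>X ** Q = mat 1\<close> and the
    first if \<open>Q ** X = mat 1\<close>; what remains is \<open>G\<close>.\<close>
  define S where "S = Q ** G + transpose G ** transpose Q - Q ** G ** transpose X ** transpose Q"
  have sym': "Q ** G ** transpose X = Q ** X ** transpose G"
    by (metis sym matrix_mul_assoc)
  show ?thesis
  proof (rule that[of S])
    have "transpose (Q ** G ** transpose X ** transpose Q) = Q ** (X ** transpose G) ** transpose Q"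
      by (simp add: matrix_transpose_mul matrix_mul_assoc)
    then have "transpose (Q ** G ** transpose X ** transpose Q) = Q ** G ** transpose X ** transpose Q"
      by (metis sym matrix_mul_assoc)
    moreover have "transpose (A + B - C) = transpose A + transpose B - transpose C"
      for A B C :: "real^'r^'r"
      by (simp add: transpose_def vec_eq_iff)
    ultimately show "transpose S = S"
      unfolding S_def by (simp add: matrix_transpose_mul add.commute)
    have XS: "X ** S = X ** Q ** G + X ** transpose G ** transpose Q
        - X ** Q ** G ** transpose X ** transpose Q"
      unfolding S_def by (simp add: matrix_add_ldistrib matrix_diff_ldistrib matrix_mul_assoc)
    show "G = X ** S"
      using Q
    proof
      assume "X ** Q = mat 1"
      then show ?thesis
        unfolding XS by (simp add: sym)
    next
      assume "Q ** X = mat 1"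
      then have "transpose X ** transpose Q = mat 1"
        by (metis matrix_transpose_mul transpose_mat)
      then have "A ** transpose X ** transpose Q = A" for A :: "real^'r^'p"
        by (metis matrix_mul_assoc matrix_mul_rid)
      then show ?thesis
        unfolding XS sym[symmetric] by simp
    qed
  qed
qed

lemma independent_image_iff:
  fixes v :: "'i \<Rightarrow> 'a::real_vector"
  assumes "finite I"
  shows "inj_on v I \<and> independent (v ` I) \<longleftrightarrow>
    (\<forall>a. (\<Sum>i\<in>I. a i *\<^sub>R v i) = 0 \<longrightarrow> (\<forall>i\<in>I. a i = 0))" (is "?L \<longleftrightarrow> ?R")
proof
  assume L: ?L
  show ?R
  proof (intro allI impI)
    fix a
    assume "(\<Sum>i\<in>I. a i *\<^sub>R v i) = 0"
    then have "(\<Sum>x\<in>v ` I. a (the_inv_into I v x) *\<^sub>R x) = 0"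
      using L by (simp add: sum.reindex the_inv_into_f_f)
    then have "\<forall>x\<in>v ` I. a (the_inv_into I v x) = 0"
      using L assms dependent_finite[of "v ` I"] by auto
    then show "\<forall>i\<in>I. a i = 0"
      using L by (simp add: the_inv_into_f_f)
  qed
next
  assume R: ?R
  have inj: "inj_on v I"
  proof (rule inj_onI, rule ccontr)
    fix i j
    assume ij: "i \<in> I" "j \<in> I" "v i = v j" "i \<noteq> j"
    \<comment> \<open>A repeated vector gives the nontrivial relation
      \<open>v i - v j = 0\<close>.\<close>
    define a :: "'i \<Rightarrow> real" where "a k = (if k = i then 1 else 0) - (if k = j then 1 else 0)" for k
    have "(\<Sum>k\<in>I. a k *\<^sub>R v k) = v i - v j"
      using ij assms by (simp add: a_def scaleR_diff_left sum_subtractf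
          if_distrib[where f = "\<lambda>c. c *\<^sub>R _"] cong: if_cong)
    then have "a i = 0"
      using R[rule_format, of a i] ij by simp
    then show False
      using ij by (simp add: a_def)
  qed
  moreover have "independent (v ` I)"
  proof (rule independent_if_scalars_zero)
    fix f x
    assume "(\<Sum>x\<in>v ` I. f x *\<^sub>R x) = 0" "x \<in> v ` I"
    then show "f x = 0"
      using R[rule_format, of "\<lambda>i. f (v i)"] by (auto simp: sum.reindex[OF inj])
  qed (use assms in simp)
  ultimately show ?L
    by simp
qed

text \<open>Each coordinate functional of the family extends linearly to the whole space and is
  represented there by a vector.\<close>

lemma dual_family:
  fixes v :: "'i \<Rightarrow> 'a::euclidean_space"
  assumes "inj_on v I" "independent (v ` I)"
  obtains w where "\<And>i j. i \<in> I \<Longrightarrow> j \<in> I \<Longrightarrow> w i \<bullet> v j = of_bool (i = j)"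
proof -
  have "\<exists>w. \<forall>j\<in>I. w \<bullet> v j = of_bool (i = j)" if "i \<in> I" for i
  proof -
    obtain g :: "'a \<Rightarrow> real" where g: "linear g" "\<forall>x\<in>v ` I. g x = of_bool (x = v i)"
      using linear_independent_extend[OF assms(2), of "\<lambda>x. of_bool (x = v i)"] by blast
    have "adjoint g 1 \<bullet> v j = of_bool (i = j)" if "j \<in> I" for j
    proof -
      have "adjoint g 1 \<bullet> v j = g (v j)"
        using adjoint_works[OF g(1), of "v j" 1] by (simp add: inner_commute)
      also have "\<dots> = of_bool (v j = v i)"
        using g(2) that by simp
      also have "v j = v i \<longleftrightarrow> i = j"
        using assms(1) that \<open>i \<in> I\<close> by (metis inj_onD)
      finally show ?thesis .
    qed
    then show ?thesis by blast
  qed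
  then have "\<exists>w. \<forall>i\<in>I. \<forall>j\<in>I. w i \<bullet> v j = of_bool (i = j)"
    by (intro bchoice) blast
  then show ?thesis
    using that by blast
qed

text \<open>The Gram matrix against the dual family of \<open>v x\<close> is the identity at \<open>x\<close>, hence
  strictly diagonally dominant nearby.\<close>

lemma independent_family_open:
  fixes v :: "'b::topological_space \<Rightarrow> 'i \<Rightarrow> 'a::euclidean_space"
  assumes fin: "finite I"
    and cont: "\<And>i. i \<in> I \<Longrightarrow> continuous_on UNIV (\<lambda>y. v y i)"
    and ind: "inj_on (v x) I" "independent (v x ` I)"
  obtains \<Omega> where "open \<Omega>" "x \<in> \<Omega>"
    "\<And>y. y \<in> \<Omega> \<Longrightarrow> inj_on (v y) I \<and> independent (v y ` I)"
proof -
  obtain w where w: "\<And>i j. i \<in> I \<Longrightarrow> j \<in> I \<Longrightarrow> w i \<bullet> v x j = of_bool (i = j)"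
    using dual_family[OF ind] by blast
  define e where "e i j y = w i \<bullet> (v y j - v x j)" for i j y
  define \<Omega> where "\<Omega> = {y. \<forall>i\<in>I. (\<Sum>j\<in>I. \<bar>e i j y\<bar>) < 1}"
  have "open {y. (\<Sum>j\<in>I. \<bar>e i j y\<bar>) < 1}" if "i \<in> I" for i
    unfolding e_def by (intro open_Collect_less continuous_intros cont)
  then have "open \<Omega>"
    unfolding \<Omega>_def Collect_ball_eq using fin by (intro open_INT) auto
  moreover have "x \<in> \<Omega>"
    unfolding \<Omega>_def e_def by simp
  moreover have "inj_on (v y) I \<and> independent (v y ` I)" if y: "y \<in> \<Omega>" for y
    unfolding independent_image_iff[OF fin]
  proof (intro allI impI ballI, rule ccontr)
    fix a k
    assume zero: "(\<Sum>j\<in>I. a j *\<^sub>R v y j) = 0" and k: "k \<in> I" "a k \<noteq> 0"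
    \<comment> \<open>For a coefficient \<open>a i\<close> of largest modulus, pairing the relation
      with \<open>w i\<close> gives \<open>\<bar>a i\<bar> \<le> \<bar>a i\<bar> * (\<Sum>j\<in>I.
      \<bar>e i j y\<bar>)\<close>, which is impossible because that sum is below
      \<open>1\<close>.\<close>
    have "Max ((\<lambda>j. \<bar>a j\<bar>) ` I) \<in> (\<lambda>j. \<bar>a j\<bar>) ` I"
      using fin k(1) by (intro Max_in) auto
    then obtain i where i: "i \<in> I" "\<bar>a i\<bar> = Max ((\<lambda>j. \<bar>a j\<bar>) ` I)"
      by auto
    have max: "\<bar>a j\<bar> \<le> \<bar>a i\<bar>" if "j \<in> I" for j
      unfolding i(2) using fin that by (intro Max_ge) auto
    have "0 = w i \<bullet> (\<Sum>j\<in>I. a j *\<^sub>R v y j)"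
      using zero by simp
    also have "\<dots> = (\<Sum>j\<in>I. a j * of_bool (i = j) + a j * e i j y)"
      unfolding inner_sum_right by (intro sum.cong refl)
        (simp add: e_def inner_diff_right algebra_simps w[OF i(1)])
    also have "\<dots> = a i + (\<Sum>j\<in>I. a j * e i j y)"
      using fin i(1) by (simp add: sum.distrib of_bool_def if_distrib[where f = "\<lambda>c. _ * c"] cong: if_cong)
    finally have "\<bar>a i\<bar> = \<bar>\<Sum>j\<in>I. a j * e i j y\<bar>"
      by linarith
    also have "\<dots> \<le> (\<Sum>j\<in>I. \<bar>a i\<bar> * \<bar>e i j y\<bar>)"
      by (rule order_trans[OF sum_abs])
        (intro sum_mono, simp add: abs_mult mult_right_mono max)
    also have "\<dots> = \<bar>a i\<bar> * (\<Sum>j\<in>I. \<bar>e i j y\<bar>)"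
      by (simp add: sum_distrib_left)
    also have "\<dots> < \<bar>a i\<bar> * 1"
      using max[OF k(1)] k(2) i(1) y unfolding \<Omega>_def by (intro mult_strict_left_mono) auto
    finally show False by simp
  qed
  ultimately show ?thesis
    using that by blast
qed

section \<open>Conservation law gradients as combinations of gradients of
  \<open>\<Psi>\<close>\<close>

lemma vconcat_nth [simp]: "vconcat U V $ Inl k = U $ k" "vconcat U V $ Inr l = V $ l"
  by (simp_all add: vconcat_def)

lemma vconcat_eq_iff: "vconcat U V = vconcat U' V' \<longleftrightarrow> U = U' \<and> V = V'"
  by (metis vconcat_nth vec_eq_iff)

lemma vconcat_matrix_mult: "vconcat U V ** S = vconcat (U ** S) (V ** S)"
  by (simp add: vec_eq_iff matrix_matrix_mult_def vconcat_def split: sum.split)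

text \<open>Identifies the combinations of gradients of \<open>\<Psi>\<close> with the pairs
  \<open>(U S, - V S)\<close>, where S runs through the symmetrised coefficient matrices.\<close>

lemma sum_form_field:
  fixes \<theta> :: "(real^'r^'n) \<times> (real^'r^'m)"
  shows "(\<Sum>i\<in>UNIV. \<Sum>j\<in>UNIV. b i j *\<^sub>R form_field (axis i 1) (axis j 1) \<theta>)
    = (fst \<theta> ** (\<chi> i j. b i j + b j i), - (snd \<theta> ** (\<chi> i j. b i j + b j i)))"
proof -
  have *: "(\<Sum>i\<in>UNIV. \<Sum>j\<in>UNIV. b i j * (x $ i * axis j 1 $ s + x $ j * axis i 1 $ s))
      = (\<Sum>i\<in>UNIV. x $ i * (b i s + b s i))" for x :: "real^'r" and s
  proof -
    have "(\<Sum>i\<in>UNIV. \<Sum>j\<in>UNIV. b i j * (x $ i * axis j 1 $ s)) = (\<Sum>i\<in>UNIV. x $ i * b i s)"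
      by (simp add: axis_def mult.commute if_distrib[where f = "\<lambda>c. _ * c"] cong: if_cong)
    moreover have "(\<Sum>i\<in>UNIV. \<Sum>j\<in>UNIV. b i j * (x $ j * axis i 1 $ s)) = (\<Sum>j\<in>UNIV. x $ j * b s j)"
      by (subst sum.swap)
        (simp add: axis_def mult.commute if_distrib[where f = "\<lambda>c. _ * c"] cong: if_cong)
    ultimately show ?thesis
      by (simp add: distrib_left sum.distrib)
  qed
  show ?thesis
    by (simp add: prod_eq_iff fst_sum snd_sum vec_eq_iff form_field_def matrix_matrix_mult_def
        inner_axis sum_negf * del: minus_add_distrib)
qed

lemma conservation_law_gradient_in_span:
  fixes U :: "real^'r^'n" and V :: "real^'r^'m"
  assumes rank: "rank (vconcat U V) = min (CARD('n) + CARD('m)) CARD('r)"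
    and \<Omega>: "open \<Omega>" "(U, V) \<in> \<Omega>" "conservation_law \<phi> \<Omega> h"
  shows "gradient h (U, V) \<in> span {form_field (axis i 1) (axis j 1) (U, V) | i j. True}"
proof -
  let ?D = "gradient h (U, V)"
  let ?X = "vconcat U V" and ?G = "vconcat (fst ?D) (- snd ?D)"
  have "?G $ p \<bullet> ?X $ q = ?G $ q \<bullet> ?X $ p" for p q
    using conservation_law_gradient_symmetric[OF \<Omega>, of p q] by simp
  then have "?G ** transpose ?X = ?X ** transpose ?G"
    by (simp add: vec_eq_iff matrix_matrix_mult_def transpose_def inner_vec_def mult.commute)
  then obtain S where S: "transpose S = S" "?G = ?X ** S"
    using full_rank_symmetric_factor[of ?X ?G] rank by auto
  have "S $ j $ i = S $ i $ j" for i j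
    using arg_cong[OF S(1), of "\<lambda>A. A $ i $ j"] by (simp add: transpose_def)
  \<comment> \<open>The coefficients are the halves of the entries of \<open>S\<close>, since
    \<open>sum_form_field\<close> adds the transposed coefficient matrix.\<close>
  then have S_half: "(\<chi> i j. S $ i $ j / 2 + S $ j $ i / 2) = S"
    by (simp add: vec_eq_iff)
  have "fst ?D = U ** S" "- snd ?D = V ** S"
    using S(2) unfolding vconcat_matrix_mult vconcat_eq_iff by auto
  then have "?D = (\<Sum>i\<in>UNIV. \<Sum>j\<in>UNIV. (S $ i $ j / 2) *\<^sub>R form_field (axis i 1) (axis j 1) (U, V))"
    unfolding sum_form_field S_half by (metis fst_conv minus_minus prod.collapse snd_conv)
  also have "\<dots> \<in> span {form_field (axis i 1) (axis j 1) (U, V) | i j. True}"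
    by (intro span_sum span_scale span_base) blast
  finally show ?thesis .
qed

section \<open>A basis of the span and its cardinality\<close>

text \<open>Unordered pairs of indices meeting \<open>C\<close>, each represented by one ordered pair; \<open>e\<close> is an
  enumeration.\<close>

definition touching_pairs :: "('r \<Rightarrow> nat) \<Rightarrow> 'r set \<Rightarrow> ('r \<times> 'r) set"
  where "touching_pairs e C = {(i, j). i \<in> C \<and> (j \<in> C \<longrightarrow> e i \<le> e j)}"

text \<open>The pairs and their swaps together are all ordered pairs meeting \<open>C\<close>, and
  they overlap exactly in the diagonal of \<open>C\<close>. With r indices and c of them in
  \<open>C\<close> this gives twice the count as r^2 - (r - c)^2 + c.\<close>

lemma card_touching_pairs:
  fixes e :: "'r::finite \<Rightarrow> nat"
  assumes e: "inj e"
  shows "2 * real (card (touching_pairs e C)) = real (card C) * (2 * real CARD('r) + 1 - real (card C))"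
proof -
  let ?P = "touching_pairs e C"
  have union: "?P \<union> prod.swap ` ?P = UNIV \<times> UNIV - (- C) \<times> (- C)"
    unfolding touching_pairs_def by (auto simp: image_iff)
  have "card (UNIV \<times> UNIV - (- C) \<times> (- C)) = card (UNIV :: ('r \<times> 'r) set) - card ((- C) \<times> (- C))"
    by (subst card_Diff_subset) auto
  then have card_union: "card (UNIV \<times> UNIV - (- C) \<times> (- C))
      = CARD('r) * CARD('r) - (CARD('r) - card C) * (CARD('r) - card C)"
    by (simp add: card_cartesian_product Compl_eq_Diff_UNIV card_Diff_subset)
  have inter: "?P \<inter> prod.swap ` ?P = (\<lambda>i. (i, i)) ` C"
    unfolding touching_pairs_def using injD[OF e] by (auto simp: image_iff order_antisym)
  have "2 * card ?P = card ?P + card (prod.swap ` ?P)"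
    by (simp add: card_image)
  also have "\<dots> = card (?P \<union> prod.swap ` ?P) + card (?P \<inter> prod.swap ` ?P)"
    by (rule card_Un_Int) simp_all
  also have "\<dots> = CARD('r) * CARD('r) - (CARD('r) - card C) * (CARD('r) - card C) + card C"
    unfolding union inter card_union by (simp add: card_image inj_on_def)
  finally have "2 * real (card ?P)
      = real (CARD('r) * CARD('r) - (CARD('r) - card C) * (CARD('r) - card C) + card C)"
    by linarith
  \<comment> \<open>Writing \<open>CARD('r)\<close> as a sum removes the truncated
    subtractions.\<close>
  moreover obtain d where d: "CARD('r) = card C + d"
    using le_Suc_ex[OF card_mono[OF finite subset_UNIV]] by blast
  ultimately show ?thesis
    unfolding d by (simp add: algebra_simps)
qed

lemma touching_family_independent:
  fixes U :: "real^'r^'n" and V :: "real^'r^'m"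
  assumes e: "inj e"
    and C: "\<And>c. (\<And>i. i \<notin> C \<Longrightarrow> c $ i = 0) \<Longrightarrow> vconcat U V *v c = 0 \<Longrightarrow> c = 0"
  defines "v \<equiv> \<lambda>(i, j). form_field (axis i 1) (axis j 1) (U, V)"
  shows "inj_on v (touching_pairs e C) \<and> independent (v ` touching_pairs e C)"
  unfolding independent_image_iff[OF finite]
proof (intro allI impI ballI)
  fix a p
  let ?P = "touching_pairs e C"
  assume zero: "(\<Sum>p\<in>?P. a p *\<^sub>R v p) = 0" and p: "p \<in> ?P"
  define b where "b i j = (if (i, j) \<in> ?P then a (i, j) else 0)" for i j
  define S :: "real^'r^'r" where "S = (\<chi> i j. b i j + b j i)"
  have "(\<Sum>i\<in>UNIV. \<Sum>j\<in>UNIV. b i j *\<^sub>R form_field (axis i 1) (axis j 1) (U, V))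
      = (\<Sum>p\<in>UNIV. b (fst p) (snd p) *\<^sub>R v p)"
    unfolding sum.cartesian_product v_def by (simp add: case_prod_beta)
  also have "\<dots> = (\<Sum>p\<in>?P. a p *\<^sub>R v p)"
    by (rule sum.mono_neutral_cong_right) (auto simp: b_def)
  finally have "U ** S = 0" "V ** S = 0"
    unfolding zero sum_form_field S_def[symmetric] by (simp_all add: zero_prod_def)
  then have XS: "vconcat U V ** S = 0"
    unfolding vconcat_matrix_mult by (simp add: vec_eq_iff vconcat_def split: sum.split)
  have sym: "S $ i $ j = S $ j $ i" for i j
    by (simp add: S_def add.commute)
  have col: "vconcat U V *v column j S = 0" for j
    using XS by (simp add: vec_eq_iff matrix_vector_mult_def matrix_matrix_mult_def column_def)
  \<comment> \<open>Columns of \<open>S\<close> outside \<open>C\<close> are supported on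
    \<open>C\<close>, hence vanish. By symmetry so do the rows outside \<open>C\<close>; now every
    column is supported on \<open>C\<close> and vanishes too.\<close>
  have "column j S = 0" if "j \<notin> C" for j
    using that by (intro C col) (auto simp: column_def S_def b_def touching_pairs_def)
  then have "S $ i $ j = 0" if "i \<notin> C" for i j
    using that sym by (metis column_def vec_lambda_beta zero_index)
  then have "column j S = 0" for j
    by (intro C col) (simp add: column_def)
  then have S0: "S $ i $ j = 0" for i j
    by (metis column_def vec_lambda_beta zero_index)
  obtain i j where ij: "p = (i, j)"
    by fastforce
  show "a p = 0"
  \<comment> \<open>A diagonal entry of \<open>S\<close> is twice the coefficient. Off the diagonal
    only one of \<open>(i, j)\<close> and \<open>(j, i)\<close> lies in \<open>?P\<close>, so the
    entry is the coefficient itself.\<close>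
  proof (cases "i = j")
    case True
    then show ?thesis
      using S0[of i i] p unfolding ij S_def b_def by simp
  next
    case False
    then have "(j, i) \<notin> ?P"
      using p injD[OF e] unfolding ij touching_pairs_def by (auto dest: order_antisym)
    then show ?thesis
      using S0[of i j] p unfolding ij S_def b_def by simp
  qed
qed

text \<open>Each axis vector differs from a vector supported on \<open>C\<close> by an element of
  the kernel of \<open>vconcat U V\<close>, and \<open>form_field\<close> is bilinear and vanishes
  on pairs from that kernel.\<close>

lemma touching_family_spans:
  fixes U :: "real^'r^'n" and V :: "real^'r^'m"
  assumes C: "\<And>i. \<exists>c. (\<forall>j. j \<notin> C \<longrightarrow> c $ j = 0) \<and> vconcat U V *v c = vconcat U V *v axis i 1"
  defines "v \<equiv> \<lambda>(i, j). form_field (axis i 1) (axis j 1) (U, V)"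
  shows "form_field (axis i 1) (axis j 1) (U, V) \<in> span (v ` touching_pairs e C)"
proof -
  let ?T = "span (v ` touching_pairs e C)"
  let ?B = "\<lambda>x y. form_field x y (U, V)"
  note lin = linear_form_field_left[of _ "(U, V)"]
  have "(k, l) \<in> touching_pairs e C \<or> (l, k) \<in> touching_pairs e C" if "k \<in> C" for k l
    using that unfolding touching_pairs_def by auto
  then have axes: "?B (axis k 1) (axis l 1) \<in> ?T" if "k \<in> C" for k l
    using that span_base[of _ "v ` touching_pairs e C"] form_field_commute[of "axis k 1" "axis l 1"]
    unfolding v_def by (smt (verit) case_prod_conv image_eqI)
  have expand: "x = (\<Sum>k\<in>UNIV. x $ k *\<^sub>R axis k 1)" for x :: "real^'r"
    by (simp add: basis_expansion flip: scalar_mult_eq_scaleR)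
  have expand_left: "?B x y = (\<Sum>k\<in>UNIV. x $ k *\<^sub>R ?B (axis k 1) y)" for x y
    by (subst expand[of x]) (simp add: linear_sum[OF lin] linear_scale[OF lin])
  have axis_left: "?B (axis k 1) y \<in> ?T" if "k \<in> C" for k y
  proof -
    have "?B (axis l 1) (axis k 1) \<in> ?T" for l
      using axes[OF that] by (simp add: form_field_commute[of "axis l 1"])
    then have "?B y (axis k 1) \<in> ?T"
      unfolding expand_left[of y] by (intro span_sum span_scale)
    then show ?thesis
      by (simp add: form_field_commute[of y])
  qed
  have supported: "?B x y \<in> ?T" if "\<And>k. k \<notin> C \<Longrightarrow> x $ k = 0" for x y
    unfolding expand_left[of x]
  proof (rule span_sum)
    fix k
    show "x $ k *\<^sub>R ?B (axis k 1) y \<in> ?T"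
      using axis_left that by (cases "k \<in> C") (auto intro: span_scale span_zero)
  qed
  have kernel: "?B x y = 0" if "vconcat U V *v x = 0" "vconcat U V *v y = 0" for x y
  proof -
    have rows: "U $ k \<bullet> z = 0" "V $ l \<bullet> z = 0" if "vconcat U V *v z = 0" for z k l
      using that by (metis matrix_vector_mul_component vconcat_nth(1) zero_index)
        (use that in \<open>metis matrix_vector_mul_component vconcat_nth(2) zero_index\<close>)
    show ?thesis
      using rows that by (simp add: form_field_def zero_prod_def vec_eq_iff)
  qed
  obtain c d where c: "\<And>k. k \<notin> C \<Longrightarrow> c $ k = 0" "vconcat U V *v c = vconcat U V *v axis i 1"
    and d: "\<And>k. k \<notin> C \<Longrightarrow> d $ k = 0" "vconcat U V *v d = vconcat U V *v axis j 1"
    using C[of i] C[of j] by blast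
  \<comment> \<open>The first two terms have an argument supported on \<open>C\<close>; the last has
    both arguments in the kernel.\<close>
  have "?B (axis i 1) (axis j 1)
      = ?B c (axis j 1) + ?B d (axis i 1 - c) + ?B (axis i 1 - c) (axis j 1 - d)"
    by (simp add: form_field_commute[of d] linear_diff[OF lin] form_field_commute[of _ "axis j 1 - d"])
      (simp add: form_field_commute[of d] form_field_commute[of "axis j 1"] linear_diff[OF lin])
  also have "?B (axis i 1 - c) (axis j 1 - d) = 0"
    using c d by (intro kernel) (simp_all add: matrix_vector_mult_diff_distrib)
  finally show ?thesis
    using supported[OF c(1)] supported[OF d(1)] by (simp add: span_add)
qed

section \<open>The span of gradients and the maximal number of independent laws\<close>

theorem corollary4p4:
  fixes U :: "real^'r^'n" and V :: "real^'r^'m" and rk :: nat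
  assumes "rank (vconcat U V) = rk"
    and "rk = min (CARD('n) + CARD('m)) CARD('r)"
  shows "(\<forall>\<Omega> h. open \<Omega> \<and> (U, V) \<in> \<Omega> \<and> conservation_law \<phi> \<Omega> h \<longrightarrow>
            gradient h (U, V) \<in> span {gradient (\<lambda>\<theta>. \<Psi> \<theta> $ i $ j) (U, V) | i j. True}) \<and>
         (\<exists>M::nat. real M = real rk * (2 * real CARD('r) + 1 - real rk) / 2 \<and>
            (\<forall>\<Omega> N h. open \<Omega> \<and> (U, V) \<in> \<Omega> \<and> independent_laws \<phi> \<Omega> N h \<longrightarrow> N \<le> M) \<and>
            (\<exists>\<Omega> i j. open \<Omega> \<and> (U, V) \<in> \<Omega> \<and>
               independent_laws \<phi> \<Omega> M (\<lambda>k \<theta>. \<Psi> \<theta> $ i k $ j k)))"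
proof -
  let ?X = "vconcat U V"
  obtain C where C: "card C = rk"
    "\<And>c. (\<And>i. i \<notin> C \<Longrightarrow> c $ i = 0) \<Longrightarrow> ?X *v c = 0 \<Longrightarrow> c = 0"
    "\<And>i. \<exists>c. (\<forall>j. j \<notin> C \<longrightarrow> c $ j = 0) \<and> ?X *v c = ?X *v axis i 1"
    using column_basis[of ?X] assms(1) by metis
  obtain e :: "'r \<Rightarrow> nat" where e: "inj e"
    using finite_imp_inj_to_nat_seg[of "UNIV :: 'r set"] by auto
  define P where "P = touching_pairs e C"
  define v :: "(real^'r^'n) \<times> (real^'r^'m) \<Rightarrow> 'r \<times> 'r \<Rightarrow> (real^'r^'n) \<times> (real^'r^'m)"
    where "v \<theta> = (\<lambda>(i, j). form_field (axis i 1) (axis j 1) \<theta>)" for \<theta>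
  have ind: "inj_on (v (U, V)) P \<and> independent (v (U, V) ` P)"
    unfolding v_def P_def by (rule touching_family_independent[OF e C(2)])
  have spans: "form_field (axis i 1) (axis j 1) (U, V) \<in> span (v (U, V) ` P)" for i j
    unfolding v_def P_def by (rule touching_family_spans[OF C(3)])
  have laws: "gradient h (U, V) \<in> span {form_field (axis i 1) (axis j 1) (U, V) | i j. True}"
    if "open \<Omega>" "(U, V) \<in> \<Omega>" "conservation_law \<phi> \<Omega> h" for \<Omega> h
    using assms by (intro conservation_law_gradient_in_span[OF _ that]) simp
  \<comment> \<open>Evaluation at the single point \<open>(U, V)\<close> suffices: there the
    \<open>N\<close> gradients are independent vectors in a space spanned by \<open>card P\<close>
    vectors.\<close>
  have bound: "N \<le> card P"
    if \<Omega>: "open \<Omega>" "(U, V) \<in> \<Omega>" and h: "independent_laws \<phi> \<Omega> N h" for \<Omega> N h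
  proof -
    let ?S = "(\<lambda>i. gradient (h i) (U, V)) ` {..<N}"
    have inj: "inj_on (\<lambda>i. gradient (h i) (U, V)) {..<N}" and indS: "independent ?S"
      and cl: "\<And>i. i < N \<Longrightarrow> conservation_law \<phi> \<Omega> (h i)"
      using h \<Omega>(2) unfolding independent_laws_def by blast+
    have "span {form_field (axis i 1) (axis j 1) (U, V) | i j. True} \<subseteq> span (v (U, V) ` P)"
      using spans by (intro span_minimal subspace_span) blast
    then have sub: "?S \<subseteq> span (v (U, V) ` P)"
      using laws[OF \<Omega> cl] by auto
    have "N = card ?S"
      using inj by (simp add: card_image)
    also have "\<dots> \<le> card (v (U, V) ` P)"
      using independent_span_bound[OF _ indS sub] by simp
    also have "\<dots> \<le> card P"
      by (intro card_image_le) simp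
    finally show ?thesis .
  qed
  have attained: "\<exists>\<Omega> i j. open \<Omega> \<and> (U, V) \<in> \<Omega> \<and>
      independent_laws \<phi> \<Omega> (card P) (\<lambda>k \<theta>. \<Psi> \<theta> $ i k $ j k)"
  proof -
    have "continuous_on UNIV (\<lambda>\<theta>. v \<theta> p)" for p
      unfolding v_def case_prod_beta
      by (intro linear_continuous_on linear_conv_bounded_linear[THEN iffD1] linear_form_field)
    then obtain \<Omega> where \<Omega>: "open \<Omega>" "(U, V) \<in> \<Omega>"
      "\<And>\<theta>. \<theta> \<in> \<Omega> \<Longrightarrow> inj_on (v \<theta>) P \<and> independent (v \<theta> ` P)"
      using independent_family_open[of P v "(U, V)"] ind by auto
    \<comment> \<open>\<open>\<pi>\<close> numbers the pairs, as families of laws are indexed by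
      natural numbers.\<close>
    obtain \<pi> where \<pi>: "bij_betw \<pi> {..<card P} P"
      using ex_bij_betw_nat_finite[of P] by (auto simp: atLeast0LessThan)
    have "inj_on (\<lambda>k. v \<theta> (\<pi> k)) {..<card P} \<and> independent ((\<lambda>k. v \<theta> (\<pi> k)) ` {..<card P})"
      if "\<theta> \<in> \<Omega>" for \<theta>
      using \<Omega>(3)[OF that] \<pi> comp_inj_on[of \<pi> "{..<card P}" "v \<theta>"]
      unfolding bij_betw_def comp_def by (metis image_image)
    then have "independent_laws \<phi> \<Omega> (card P) (\<lambda>k \<theta>. \<Psi> \<theta> $ fst (\<pi> k) $ snd (\<pi> k))"
      unfolding independent_laws_def gradient_Psi
      by (simp add: conservation_law_Psi v_def case_prod_beta)
    then show ?thesis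
      using \<Omega>(1,2) by (intro exI[of _ \<Omega>] exI[of _ "\<lambda>k. fst (\<pi> k)"] exI[of _ "\<lambda>k. snd (\<pi> k)"]) simp
  qed
  have "real (card P) = real rk * (2 * real CARD('r) + 1 - real rk) / 2"
    using card_touching_pairs[OF e, of C] unfolding P_def C(1) by simp
  then show ?thesis
    unfolding gradient_Psi using laws bound attained by blast
qed

end
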